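(* Let the automorphisms $\tau$ and $\sigma$ of $\mathrm{Spin}_8$ act on $X=\mathbb{S}^7\times\mathbb{S}^7\cong\mathrm{Spin}_8/G_2$, and let $\hat\Gamma=\langle\tau,\sigma\rangle$. Then the fixed set of $\tau$ in $X$ is $$\mathrm{Fix}(\tau)=\{(x,\overline x):x\in\mathbb{O},\ x^3=1\}=\{(1,1)\}\cup Y,\qquad Y=\left\{(x,\overline x): x=\tfrac12\left(-1+\sqrt3\,v\right),\ v\in\mathbb{S}^6\right\},$$ where $\mathbb{S}^6$ is the unit sphere in $\mathrm{Im}\,\mathbb{O}$; the fixed set of $\sigma$ in $X$ is the diagonal $\mathrm{Fix}(\sigma)=\{(x,x):x\in\mathbb{S}^7\}$; and $$\mathrm{Fix}(\hat\Gamma)=\mathrm{Fix}(\sigma)\cap\mathrm{Fix}(\tau)=\{(1,1)\}.$$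
   Context: $\mathbb{O}\cong\mathbb{R}^8$ denotes the octonions with the standard Euclidean norm, $x\mapsto\overline x$ is octonionic conjugation, $\kappa=\mathrm{diag}(1,-1,\dots,-1)$ is its matrix, $\mathrm{Im}\,\mathbb{O}\cong\mathbb{R}^7$ is the orthogonal complement of $\mathbb{R}\cdot 1$, and $\mathbb{S}^7$ is the unit sphere of $\mathbb{O}$. For $D\in SO_8$ put $\tilde D=\kappa D\kappa\in SO_8$. $\mathrm{Spin}_8$ is realized as the group of triples $(A,B,C)\in(SO_8)^3$ satisfying $B(x\cdot y)=(Cx)\cdot(Ay)$ for all $x,y\in\mathbb{O}$. The triality automorphism (of order 3) is $\tau(A,B,C)=(\tilde B,\tilde C,A)$, and $\sigma$ is the involution $\sigma(A,B,C)=(B,A,\tilde C)$; both are automorphisms of $\mathrm{Spin}_8$. $G_2=\mathrm{Aut}(\mathbb{O})$ is embedded in $\mathrm{Spin}_8$ as $\{(A,A,A):A\in\mathrm{Aut}(\mathbb{O})\}$; it is fixed pointwise by $\tau$ and $\sigma$. $\mathrm{Spin}_8$ acts on $X=\mathbb{S}^7\times\mathbb{S}^7$ by $(A,B,C)\cdot(x,y)=(Ax,By)$, transitively and with isotropy group $G_2$ at $o=(1,1)$, so $X\cong\mathrm{Spin}_8/G_2$ via $gG_2\mapsto g\cdot o$. Every $\gamma\in\hat\Gamma$ acts on $X$ by $\gamma(g\cdot o)=\gamma(g)\cdot o$ for $g\in\mathrm{Spin}_8$. $\mathrm{Fix}$ denotes the set of points of $X$ fixed by the given transformation, or by every element of the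 given group. *)

theory Defs
  imports
    "HOL-Analysis.Analysis"
    "HOL-Algebra.Bij"
    "HOL-Algebra.Generated_Groups"
begin

text \<open>The octonions are \<^typ>\<open>real^8\<close> with its Euclidean norm. In the index type \<^typ>\<open>8\<close> we
  have $8 = 0$; the basis vector with index $0$ is the unit, and the imaginary units are
  multiplied by the rule $e_i e_{i+1} = e_{i+3}$ together with its cyclic permutations
  (indices $1,\dots,7$ modulo $7$), with $e_i^2 = -1$ and $e_i e_j = -e_j e_i$ for $i \neq j$.\<close>

type_synonym oct = "real^8"

definition oct_one :: oct where
  "oct_one = axis 0 1"

definition oct_mult :: "oct \<Rightarrow> oct \<Rightarrow> oct" (infixl \<open>\<odot>\<close> 70) where
  "x \<odot> y = (\<chi> k.
     if k = 0 then
       x$0 * y$0 - x$1 * y$1 - x$2 * y$2 - x$3 * y$3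
       - x$4 * y$4 - x$5 * y$5 - x$6 * y$6 - x$7 * y$7
     else if k = 1 then
       x$0 * y$1 + x$1 * y$0 + x$2 * y$4 + x$3 * y$7
       - x$4 * y$2 + x$5 * y$6 - x$6 * y$5 - x$7 * y$3
     else if k = 2 then
       x$0 * y$2 - x$1 * y$4 + x$2 * y$0 + x$3 * y$5
       + x$4 * y$1 - x$5 * y$3 + x$6 * y$7 - x$7 * y$6
     else if k = 3 then
       x$0 * y$3 - x$1 * y$7 - x$2 * y$5 + x$3 * y$0
       + x$4 * y$6 + x$5 * y$2 - x$6 * y$4 + x$7 * y$1
     else if k = 4 then
       x$0 * y$4 + x$1 * y$2 - x$2 * y$1 - x$3 * y$6
       + x$4 * y$0 + x$5 * y$7 + x$6 * y$3 - x$7 * y$5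
     else if k = 5 then
       x$0 * y$5 - x$1 * y$6 + x$2 * y$3 - x$3 * y$2
       - x$4 * y$7 + x$5 * y$0 + x$6 * y$1 + x$7 * y$4
     else if k = 6 then
       x$0 * y$6 + x$1 * y$5 - x$2 * y$7 + x$3 * y$4
       - x$4 * y$3 - x$5 * y$1 + x$6 * y$0 + x$7 * y$2
     else
       x$0 * y$7 + x$1 * y$3 + x$2 * y$6 - x$3 * y$1
       + x$4 * y$5 - x$5 * y$4 - x$6 * y$2 + x$7 * y$0)"

definition oct_cnj :: "oct \<Rightarrow> oct" where
  "oct_cnj x = (\<chi> k. if k = 0 then x$k else - x$k)"

definition Im_oct :: "oct set" where
  "Im_oct = (span {oct_one})\<^sup>\<bottom>"

definition kappa :: "real^8^8" where
  "kappa = (\<chi> i j. if i = j then (if i = 0 then 1 else -1) else 0)"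

definition tilde :: "real^8^8 \<Rightarrow> real^8^8" where
  "tilde D = kappa ** D ** kappa"

type_synonym triple = "(real^8^8) \<times> (real^8^8) \<times> (real^8^8)"

definition Spin8 :: "triple monoid" where
  "Spin8 = \<lparr>
     carrier = {(A, B, C). rotation_matrix A \<and> rotation_matrix B \<and> rotation_matrix C \<and>
                  (\<forall>x y. B *v (x \<odot> y) = (C *v x) \<odot> (A *v y))},
     mult = (\<lambda>(A, B, C) (A', B', C'). (A ** A', B ** B', C ** C')),
     one = (mat 1, mat 1, mat 1)\<rparr>"

text \<open>Automorphisms are extensional functions, as in \<^const>\<open>AutoGroup\<close>.\<close>

definition tau :: "triple \<Rightarrow> triple" where
  "tau = (\<lambda>(A, B, C) \<in> carrier Spin8. (tilde B, tilde C, A))"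

definition sigma :: "triple \<Rightarrow> triple" where
  "sigma = (\<lambda>(A, B, C) \<in> carrier Spin8. (B, A, tilde C))"

definition Gamma_hat :: "(triple \<Rightarrow> triple) set" where
  "Gamma_hat = generate (AutoGroup Spin8) {tau, sigma}"

definition X :: "(oct \<times> oct) set" where
  "X = sphere 0 1 \<times> sphere 0 1"

definition base_pt :: "oct \<times> oct" where
  "base_pt = (oct_one, oct_one)"

fun spin8_act :: "triple \<Rightarrow> oct \<times> oct \<Rightarrow> oct \<times> oct" where
  "spin8_act (A, B, C) (x, y) = (A *v x, B *v y)"

text \<open>The transformation of \<^const>\<open>X\<close> induced by \<open>\<gamma>\<close>, that is, \<open>g \<cdot> o \<mapsto> \<gamma>(g) \<cdot> o\<close>. It does not
  depend on the choice of \<open>g\<close>, see \<open>aut_act_eq\<close> below.\<close>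

definition aut_act :: "(triple \<Rightarrow> triple) \<Rightarrow> oct \<times> oct \<Rightarrow> oct \<times> oct" where
  "aut_act \<gamma> p = (THE q. \<exists>g\<in>carrier Spin8. spin8_act g base_pt = p \<and> q = spin8_act (\<gamma> g) base_pt)"

definition Fix :: "(triple \<Rightarrow> triple) \<Rightarrow> (oct \<times> oct) set" where
  "Fix \<gamma> = {p \<in> X. aut_act \<gamma> p = p}"

definition Fix_group :: "(triple \<Rightarrow> triple) set \<Rightarrow> (oct \<times> oct) set" where
  "Fix_group \<Gamma> = {p \<in> X. \<forall>\<gamma>\<in>\<Gamma>. aut_act \<gamma> p = p}"

subsection \<open>Basic facts, showing that the notions above are well defined\<close>

lemma UNIV_8: "(UNIV :: 8 set) = {0, 1, 2, 3, 4, 5, 6, 7}"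
  by (rule sym, rule card_subset_eq) auto

lemma forall_8: "(\<forall>i::8. P i) \<longleftrightarrow> P 0 \<and> P 1 \<and> P 2 \<and> P 3 \<and> P 4 \<and> P 5 \<and> P 6 \<and> P 7"
proof -
  have "(\<forall>i::8. P i) \<longleftrightarrow> (\<forall>i\<in>(UNIV::8 set). P i)" by simp
  then show ?thesis unfolding UNIV_8 by simp
qed

lemma sum_8: "sum f (UNIV :: 8 set) = f 0 + f 1 + f 2 + f 3 + f 4 + f 5 + f 6 + f 7"
  for f :: "8 \<Rightarrow> 'a::comm_monoid_add"
  unfolding UNIV_8 by (simp add: add.assoc)

lemma oct_one_mult [simp]: "oct_one \<odot> x = x" "x \<odot> oct_one = x"
  by (simp_all add: oct_one_def oct_mult_def vec_eq_iff forall_8 axis_def)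

lemma oct_zero_mult [simp]: "0 \<odot> x = 0" "x \<odot> 0 = 0"
  by (simp_all add: oct_mult_def vec_eq_iff)

lemma oct_mult_scaleR [simp]: "(r *\<^sub>R x) \<odot> y = r *\<^sub>R (x \<odot> y)" "x \<odot> (r *\<^sub>R y) = r *\<^sub>R (x \<odot> y)"
  by (simp_all add: oct_mult_def vec_eq_iff forall_8 algebra_simps)

lemma norm_oct: "(norm x)\<^sup>2 = (x$0)\<^sup>2 + (x$1)\<^sup>2 + (x$2)\<^sup>2 + (x$3)\<^sup>2 + (x$4)\<^sup>2 + (x$5)\<^sup>2 + (x$6)\<^sup>2 + (x$7)\<^sup>2"
  for x :: oct
  unfolding power2_norm_eq_inner inner_vec_def sum_8 by (simp only: power2_eq_square inner_real_def)

lemma norm_oct_mult: "norm (x \<odot> y) = norm x * norm y"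
proof -
  have "(norm (x \<odot> y))\<^sup>2 = (norm x * norm y)\<^sup>2"
    unfolding power_mult_distrib norm_oct
    by (simp add: oct_mult_def power2_eq_square algebra_simps)
  then show ?thesis by simp
qed

lemma oct_cnj_cnj [simp]: "oct_cnj (oct_cnj x) = x"
  by (simp add: oct_cnj_def vec_eq_iff)

lemma oct_cnj_one [simp]: "oct_cnj oct_one = oct_one"
  by (simp add: oct_cnj_def oct_one_def axis_def vec_eq_iff)

lemma oct_cnj_scaleR [simp]: "oct_cnj (r *\<^sub>R x) = r *\<^sub>R oct_cnj x"
  by (simp add: oct_cnj_def vec_eq_iff)

lemma norm_oct_cnj [simp]: "norm (oct_cnj x) = norm x"
proof -
  have "(norm (oct_cnj x))\<^sup>2 = (norm x)\<^sup>2"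
    unfolding norm_oct by (simp add: oct_cnj_def)
  then show ?thesis by simp
qed

lemma oct_cnj_mult: "oct_cnj (x \<odot> y) = oct_cnj y \<odot> oct_cnj x"
  by (simp add: oct_cnj_def oct_mult_def vec_eq_iff forall_8)

lemma mult_cnj_right: "(x \<odot> y) \<odot> oct_cnj y = (norm y)\<^sup>2 *\<^sub>R x"
  unfolding norm_oct
  by (simp add: oct_cnj_def oct_mult_def vec_eq_iff forall_8 power2_eq_square algebra_simps)

lemma mult_cnj_left: "oct_cnj x \<odot> (x \<odot> y) = (norm x)\<^sup>2 *\<^sub>R y"
  using arg_cong[OF mult_cnj_right[of "oct_cnj y" "oct_cnj x"], of oct_cnj]
  by (simp add: oct_cnj_mult)

lemma mult_cnj_right': "(x \<odot> oct_cnj y) \<odot> y = (norm y)\<^sup>2 *\<^sub>R x"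
  using mult_cnj_right[of x "oct_cnj y"] by simp

lemma kappa_mult: "kappa *v x = oct_cnj x"
  by (simp add: kappa_def oct_cnj_def matrix_vector_mult_def vec_eq_iff forall_8 sum_8)

lemma kappa_kappa: "kappa ** kappa = mat 1"
  by (simp add: matrix_eq matrix_vector_mul_assoc[symmetric] kappa_mult)

lemma tilde_mult: "tilde D *v x = oct_cnj (D *v oct_cnj x)"
  by (simp add: tilde_def matrix_vector_mul_assoc[symmetric] kappa_mult)

lemma tilde_tilde [simp]: "tilde (tilde D) = D"
  by (simp add: matrix_eq tilde_mult)

lemma tilde_mul: "tilde (A ** B) = tilde A ** tilde B"
  by (simp add: matrix_eq tilde_mult matrix_vector_mul_assoc[symmetric])

lemma rotation_tilde: "rotation_matrix D \<Longrightarrow> rotation_matrix (tilde D)"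
proof -
  assume D: "rotation_matrix D"
  have t: "transpose kappa = kappa"
    by (auto simp: kappa_def transpose_def vec_eq_iff)
  have k: "orthogonal_matrix kappa"
    by (simp add: orthogonal_matrix_def t kappa_kappa)
  have "det kappa * det kappa = 1"
    by (metis det_I det_mul kappa_kappa)
  then have "det (tilde D) = 1"
    using D by (simp add: tilde_def det_mul rotation_matrix_def)
  then show ?thesis
    using D k by (simp add: tilde_def rotation_matrix_def orthogonal_matrix_mul)
qed

lemma Spin8_iff:
  "(A, B, C) \<in> carrier Spin8 \<longleftrightarrow> rotation_matrix A \<and> rotation_matrix B \<and> rotation_matrix C \<and>
     (\<forall>x y. B *v (x \<odot> y) = (C *v x) \<odot> (A *v y))"
  by (simp add: Spin8_def)

lemma Spin8_mult [simp]: "(A, B, C) \<otimes>\<^bsub>Spin8\<^esub> (A', B', C') = (A ** A', B ** B', C ** C')"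
  by (simp add: Spin8_def)

lemma Spin8_one [simp]: "\<one>\<^bsub>Spin8\<^esub> = (mat 1, mat 1, mat 1)"
  by (simp add: Spin8_def)

lemma rotation_norm: "rotation_matrix A \<Longrightarrow> norm (A *v x) = norm x" for A :: "real^'n^'n"
  by (metis matrix_of_matrix_vector_mul matrix_vector_mul_linear orthogonal_transformation_matrix
      orthogonal_transformation_norm rotation_matrix_def)

lemma rotation_mult: "rotation_matrix A \<Longrightarrow> rotation_matrix B \<Longrightarrow> rotation_matrix (A ** B)"
  for A B :: "real^'n^'n"
  by (simp add: rotation_matrix_def orthogonal_matrix_mul det_mul)

lemma rotation_transpose:
  "rotation_matrix A \<Longrightarrow> rotation_matrix (transpose A)"
  "rotation_matrix A \<Longrightarrow> transpose A ** A = mat 1"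
  "rotation_matrix A \<Longrightarrow> A ** transpose A = mat 1"
  for A :: "real^'n^'n"
  by (auto simp: rotation_matrix_def orthogonal_matrix_def)

lemma Spin8_closed:
  "(A, B, C) \<in> carrier Spin8 \<Longrightarrow> (A', B', C') \<in> carrier Spin8 \<Longrightarrow>
     (A ** A', B ** B', C ** C') \<in> carrier Spin8"
  by (simp add: Spin8_iff rotation_mult matrix_vector_mul_assoc[symmetric])

lemma group_Spin8: "group Spin8"
proof (rule groupI)
  fix g h assume "g \<in> carrier Spin8" "h \<in> carrier Spin8"
  then show "g \<otimes>\<^bsub>Spin8\<^esub> h \<in> carrier Spin8"
    by (cases g; cases h) (simp add: Spin8_closed)
next
  show "\<one>\<^bsub>Spin8\<^esub> \<in> carrier Spin8"
    by (simp add: Spin8_iff rotation_matrix_def orthogonal_matrix_id)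
next
  fix g h k
  show "g \<otimes>\<^bsub>Spin8\<^esub> h \<otimes>\<^bsub>Spin8\<^esub> k = g \<otimes>\<^bsub>Spin8\<^esub> (h \<otimes>\<^bsub>Spin8\<^esub> k)"
    by (cases g; cases h; cases k) (simp add: matrix_mul_assoc)
next
  fix g show "\<one>\<^bsub>Spin8\<^esub> \<otimes>\<^bsub>Spin8\<^esub> g = g"
    by (cases g) simp
next
  fix g assume g: "g \<in> carrier Spin8"
  obtain A B C where gg: "g = (A, B, C)" by (cases g)
  have r: "rotation_matrix A" "rotation_matrix B" "rotation_matrix C"
    and e: "\<And>x y. B *v (x \<odot> y) = (C *v x) \<odot> (A *v y)"
    using g gg by (auto simp: Spin8_iff)
  have "transpose B *v (x \<odot> y) = (transpose C *v x) \<odot> (transpose A *v y)" for x y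
  proof -
    have "B *v ((transpose C *v x) \<odot> (transpose A *v y)) = x \<odot> y"
      by (simp add: e matrix_vector_mul_assoc rotation_transpose r del: transpose_matrix_vector)
    then have "transpose B *v (x \<odot> y) = transpose B *v (B *v ((transpose C *v x) \<odot> (transpose A *v y)))"
      by simp
    then show ?thesis
      by (simp add: matrix_vector_mul_assoc rotation_transpose r del: transpose_matrix_vector)
  qed
  then have "(transpose A, transpose B, transpose C) \<in> carrier Spin8"
    by (simp add: Spin8_iff rotation_transpose r)
  moreover have "(transpose A, transpose B, transpose C) \<otimes>\<^bsub>Spin8\<^esub> g = \<one>\<^bsub>Spin8\<^esub>"
    by (simp add: gg rotation_transpose r)
  ultimately show "\<exists>h\<in>carrier Spin8. h \<otimes>\<^bsub>Spin8\<^esub> g = \<one>\<^bsub>Spin8\<^esub>" by blast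
qed

lemma Spin8_C:
  assumes "(A, B, C) \<in> carrier Spin8"
  shows "C *v (x \<odot> y) = (B *v x) \<odot> (tilde A *v y)"
proof (cases "y = 0")
  case False
  define z where "z = oct_cnj y"
  have r: "norm (A *v z) = norm y" and e: "\<And>x y. B *v (x \<odot> y) = (C *v x) \<odot> (A *v y)"
    using assms by (auto simp: Spin8_iff rotation_norm z_def)
  have "(norm y)\<^sup>2 *\<^sub>R (B *v x) = B *v ((x \<odot> y) \<odot> z)"
    by (simp add: z_def mult_cnj_right matrix_vector_mult_scaleR)
  also have "\<dots> = (C *v (x \<odot> y)) \<odot> (A *v z)" by (rule e)
  finally have "(norm y)\<^sup>2 *\<^sub>R ((B *v x) \<odot> oct_cnj (A *v z)) = (norm y)\<^sup>2 *\<^sub>R (C *v (x \<odot> y))"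
    by (metis mult_cnj_right oct_mult_scaleR(1) r)
  then show ?thesis using False by (simp add: tilde_mult z_def)
qed simp

lemma Spin8_A:
  assumes "(A, B, C) \<in> carrier Spin8"
  shows "A *v (x \<odot> y) = (tilde C *v x) \<odot> (B *v y)"
proof (cases "x = 0")
  case False
  define z where "z = oct_cnj x"
  have r: "norm (C *v z) = norm x" and e: "\<And>x y. B *v (x \<odot> y) = (C *v x) \<odot> (A *v y)"
    using assms by (auto simp: Spin8_iff rotation_norm z_def)
  have "(norm x)\<^sup>2 *\<^sub>R (B *v y) = B *v (z \<odot> (x \<odot> y))"
    by (simp add: z_def mult_cnj_left matrix_vector_mult_scaleR)
  also have "\<dots> = (C *v z) \<odot> (A *v (x \<odot> y))" by (rule e)
  finally have "(norm x)\<^sup>2 *\<^sub>R (oct_cnj (C *v z) \<odot> (B *v y)) = (norm x)\<^sup>2 *\<^sub>R (A *v (x \<odot> y))"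
    by (metis mult_cnj_left oct_mult_scaleR(2) r)
  then show ?thesis using False by (simp add: tilde_mult z_def)
qed simp

lemma tau_carrier: "(A, B, C) \<in> carrier Spin8 \<Longrightarrow> (tilde B, tilde C, A) \<in> carrier Spin8"
  using Spin8_C[of A B C]
  by (auto simp: Spin8_iff rotation_tilde tilde_mult[of C] tilde_mult[of B] tilde_mult[of A] oct_cnj_mult)

lemma tau_carrier2: "(A, B, C) \<in> carrier Spin8 \<Longrightarrow> (C, tilde A, tilde B) \<in> carrier Spin8"
  using tau_carrier[OF tau_carrier, of A B C] by simp

lemma sigma_carrier: "(A, B, C) \<in> carrier Spin8 \<Longrightarrow> (B, A, tilde C) \<in> carrier Spin8"
  using Spin8_A[of A B C] by (auto simp: Spin8_iff rotation_tilde)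

lemma tau_auto: "tau \<in> auto Spin8"
proof -
  have "bij_betw tau (carrier Spin8) (carrier Spin8)"
    by (rule bij_betw_byWitness[where f' = "tau \<circ> tau"]) (auto simp: tau_def tau_carrier tau_carrier2)
  moreover have "tau \<in> hom Spin8 Spin8"
    by (auto simp: hom_def tau_def tau_carrier tilde_mul Spin8_closed)
  ultimately show ?thesis
    by (simp add: auto_def Bij_def tau_def)
qed

lemma sigma_auto: "sigma \<in> auto Spin8"
proof -
  have "bij_betw sigma (carrier Spin8) (carrier Spin8)"
    by (rule bij_betw_byWitness[where f' = sigma]) (auto simp: sigma_def sigma_carrier)
  moreover have "sigma \<in> hom Spin8 Spin8"
    by (auto simp: hom_def sigma_def sigma_carrier tilde_mul Spin8_closed)
  ultimately show ?thesis
    by (simp add: auto_def Bij_def sigma_def)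
qed

lemma spin8_act_mult: "spin8_act (g \<otimes>\<^bsub>Spin8\<^esub> h) p = spin8_act g (spin8_act h p)"
  by (cases g; cases h; cases p) (simp add: matrix_vector_mul_assoc)

lemma isotropy:
  assumes "g \<in> carrier Spin8" "spin8_act g base_pt = base_pt"
  obtains A where "g = (A, A, A)" "tilde A = A"
proof -
  obtain A B C where g: "g = (A, B, C)" by (cases g)
  have e: "B *v (x \<odot> y) = (C *v x) \<odot> (A *v y)" for x y
    using assms g by (simp add: Spin8_iff)
  have 1: "A *v oct_one = oct_one" "B *v oct_one = oct_one"
    using assms g by (auto simp: base_pt_def)
  have "B *v x = C *v x" for x
    using e[of x oct_one] 1 by simp
  then have BC: "B = C"
    by (simp add: matrix_eq)
  have "B *v x = A *v x" for x
    using e[of oct_one x] 1 BC by simp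
  then have BA: "B = A"
    by (simp add: matrix_eq)
  have "C *v x = tilde A *v x" for x
    using Spin8_C[of A B C oct_one x] assms g 1 by simp
  then have "C = tilde A"
    by (simp add: matrix_eq)
  then show thesis using that g BC BA by simp
qed

lemma Gamma_hat_auto:
  assumes "\<gamma> \<in> Gamma_hat"
  shows "\<gamma> \<in> auto Spin8"
  using assms group.generate_in_carrier[OF group.AutoGroup[OF group_Spin8], of "{tau, sigma}" \<gamma>]
  by (simp add: Gamma_hat_def AutoGroup_def tau_auto sigma_auto)

lemma Gamma_hat_isotropy:
  assumes "\<gamma> \<in> Gamma_hat" "g \<in> carrier Spin8" "spin8_act g base_pt = base_pt"
  shows "\<gamma> g = g"
proof -
  obtain A where A: "g = (A, A, A)" "tilde A = A" using isotropy assms(2,3) .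
  have Bij: "f \<in> Bij (carrier Spin8)" if "f \<in> auto Spin8" for f
    using that by (simp add: auto_def)
  have base: "f g = g" if "f \<in> {tau, sigma}" for f
    using that assms(2) A by (auto simp: tau_def sigma_def)
  have "\<gamma> \<in> generate (AutoGroup Spin8) {tau, sigma}"
    using assms(1) by (simp add: Gamma_hat_def)
  then show ?thesis
  proof (induction rule: generate.induct)
    case one
    show ?case using assms(2) by (simp add: AutoGroup_def BijGroup_def)
  next
    case (incl h)
    then show ?case by (rule base)
  next
    case (inv h)
    then have h: "h \<in> auto Spin8" using tau_auto sigma_auto by auto
    have eq: "inv\<^bsub>AutoGroup Spin8\<^esub> h = inv\<^bsub>BijGroup (carrier Spin8)\<^esub> h"
      unfolding AutoGroup_def
      by (rule group.m_inv_consistent[OF group_BijGroup group.subgroup_auto[OF group_Spin8] h])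
    have "(inv\<^bsub>BijGroup (carrier Spin8)\<^esub> h) g = g"
      using base[OF inv] assms(2) Bij[OF h]
      by (simp add: inv_BijGroup Bij_def bij_betw_def inv_into_f_eq)
    then show ?case by (simp add: eq)
  next
    case (eng h1 h2)
    then have "h1 \<in> auto Spin8" "h2 \<in> auto Spin8"
      using Gamma_hat_auto by (auto simp: Gamma_hat_def)
    then show ?case
      using eng.IH assms(2) by (simp add: AutoGroup_def BijGroup_def Bij compose_def)
  qed
qed

lemma aut_act_eq:
  assumes \<gamma>: "\<gamma> \<in> Gamma_hat" and g: "g \<in> carrier Spin8"
  shows "aut_act \<gamma> (spin8_act g base_pt) = spin8_act (\<gamma> g) base_pt"
proof -
  interpret Spin8: group Spin8 by (rule group_Spin8)
  have wd: "spin8_act (\<gamma> h) base_pt = spin8_act (\<gamma> g) base_pt"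
    if h: "h \<in> carrier Spin8" and eq: "spin8_act h base_pt = spin8_act g base_pt" for h
  proof -
    define k where "k = inv\<^bsub>Spin8\<^esub> g \<otimes>\<^bsub>Spin8\<^esub> h"
    have k: "k \<in> carrier Spin8" using g h by (simp add: k_def)
    have kfix: "spin8_act k base_pt = base_pt"
    proof -
      have "spin8_act k base_pt = spin8_act (inv\<^bsub>Spin8\<^esub> g \<otimes>\<^bsub>Spin8\<^esub> g) base_pt"
        by (simp only: k_def spin8_act_mult eq)
      also have "\<dots> = base_pt"
        unfolding Spin8.l_inv[OF g] by (simp add: base_pt_def)
      finally show ?thesis .
    qed
    have "h = g \<otimes>\<^bsub>Spin8\<^esub> k"
      using g h by (simp add: k_def Spin8.m_assoc[symmetric] del: Spin8_one)
    then have "\<gamma> h = \<gamma> g \<otimes>\<^bsub>Spin8\<^esub> k"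
      using Gamma_hat_auto[OF \<gamma>] Gamma_hat_isotropy[OF \<gamma> k kfix] g k
      by (auto simp: auto_def hom_mult)
    then show ?thesis using kfix by (simp add: spin8_act_mult)
  qed
  show ?thesis
    unfolding aut_act_def
  proof (rule the_equality)
    show "\<exists>h\<in>carrier Spin8. spin8_act h base_pt = spin8_act g base_pt \<and>
            spin8_act (\<gamma> g) base_pt = spin8_act (\<gamma> h) base_pt"
      using g by blast
  next
    fix q
    assume "\<exists>h\<in>carrier Spin8. spin8_act h base_pt = spin8_act g base_pt \<and>
              q = spin8_act (\<gamma> h) base_pt"
    then show "q = spin8_act (\<gamma> g) base_pt" using wd by blast
  qed
qed

end

theory Submission
  imports Defs
begin

text \<open>
  Why the theorem holds. If \<open>g = (A, B, C)\<close> carries the base point \<open>(1, 1)\<close> to \<open>(x, y)\<close>, then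
  \<open>A 1 = x\<close>, \<open>B 1 = y\<close>, and the defining relation at \<open>1 \<cdot> 1\<close> forces \<open>C 1 = y \<cdot> cnj x\<close>. Hence
  \<open>\<tau>\<close> acts by \<open>(x, y) \<mapsto> (cnj y, x \<cdot> cnj y)\<close> and \<open>\<sigma>\<close> by \<open>(x, y) \<mapsto> (y, x)\<close>
  (\<open>aut_act_tau\<close>, \<open>aut_act_sigma\<close>). The fixed points of \<open>\<sigma>\<close> are visible; those of \<open>\<tau>\<close> satisfy
  \<open>y = cnj x = x\<^sup>2\<close>, which for unit vectors is \<open>x\<^sup>3 = 1\<close>. The solutions of this equation come
  from the quadratic equation that every octonion satisfies. Finally, a diagonal point fixed
  by \<open>\<tau>\<close> has \<open>x = cnj x = x\<^sup>2\<close>, so it is the base point, and the base point is fixed by every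
  automorphism in the group.

  These formulas hold on all of \<open>S\<^sup>7 \<times> S\<^sup>7\<close> only because the action is transitive, and this is
  the main work (\<open>Spin8_transitive\<close>). Left multiplications \<open>L\<^sub>u\<close> by unit octonions give elements
  \<open>(L\<^bsub>cnj u\<^esub>, L\<^sub>u, L\<^sub>u R\<^sub>u)\<close> of the group by a Moufang identity, and \<open>\<tau>\<close> turns them into
  elements \<open>(R\<^sub>u, L\<^sub>u R\<^sub>u, L\<^sub>u)\<close>. The product of the two for the same \<open>u\<close> sends \<open>(1, 1)\<close>
  to \<open>(1, u\<^sup>3)\<close>, and every unit octonion is a cube; a further element of the second kind
  reaches \<open>(x, y)\<close>. Roots are extracted by de Moivre's formula in the copy of the complex numbers
  that contains a given octonion. Square roots also show that the multiplications have determinant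
  \<open>1\<close>, because \<open>L\<^bsub>s\<cdot>s\<^esub> = L\<^sub>s L\<^sub>s\<close>.
\<close>

section \<open>Octonion identities\<close>

lemma oct_mult_add:
  "(x + y) \<odot> z = x \<odot> z + y \<odot> z" "z \<odot> (x + y) = z \<odot> x + z \<odot> y"
  by (simp_all add: oct_mult_def vec_eq_iff forall_8 algebra_simps)

lemma oct_mult_diff:
  "(x - y) \<odot> z = x \<odot> z - y \<odot> z" "z \<odot> (x - y) = z \<odot> x - z \<odot> y"
  by (simp_all add: oct_mult_def vec_eq_iff forall_8 algebra_simps)

lemma oct_cnj_add: "oct_cnj (x + y) = oct_cnj x + oct_cnj y"
  by (simp add: oct_cnj_def vec_eq_iff)

lemma oct_cnj_eq: "oct_cnj x = (2 * x$0) *\<^sub>R oct_one - x"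
  by (simp add: oct_cnj_def oct_one_def axis_def vec_eq_iff)

lemma oct_cnj_mult_self: "oct_cnj x \<odot> x = (norm x)\<^sup>2 *\<^sub>R oct_one"
  using mult_cnj_left[of x oct_one] by simp

lemma norm_oct_one [simp]: "norm oct_one = 1"
  by (simp add: oct_one_def)

lemma oct_mult_self: "x \<odot> x = (2 * x$0) *\<^sub>R x - (norm x)\<^sup>2 *\<^sub>R oct_one"
proof -
  have "(oct_cnj x + x) \<odot> x = (2 * x$0) *\<^sub>R x"
    by (simp add: oct_cnj_eq)
  then show ?thesis
    by (simp add: oct_mult_add oct_cnj_mult_self algebra_simps)
qed

lemma oct_left_alternative: "x \<odot> (x \<odot> y) = (x \<odot> x) \<odot> y"
proof -
  have "x \<odot> (x \<odot> y) = (2 * x$0) *\<^sub>R (x \<odot> y) - oct_cnj x \<odot> (x \<odot> y)"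
    by (simp add: oct_cnj_eq oct_mult_diff)
  then show ?thesis by (simp add: mult_cnj_left oct_mult_self oct_mult_diff)
qed

lemma Im_oct_iff: "v \<in> Im_oct \<longleftrightarrow> v$0 = 0"
proof -
  have "v \<in> Im_oct \<longleftrightarrow> (\<forall>r. r * v$0 = 0)"
    by (auto simp: Im_oct_def orthogonal_comp_def span_singleton orthogonal_def oct_one_def
        inner_axis')
  then show ?thesis by (metis mult_1 mult_zero_right)
qed

text \<open>Polarization of \<open>cnj c (c z) = \<bar>c\<bar>\<^sup>2 z\<close>, written with \<open>x = cnj c\<close>. It allows
  factors to be exchanged without associativity.\<close>

lemma oct_mult_polarized:
  "x \<odot> (u \<odot> z) + oct_cnj u \<odot> (oct_cnj x \<odot> z) = (2 * (oct_cnj x \<bullet> u)) *\<^sub>R z"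
proof -
  define c where "c = oct_cnj x"
  have x: "x = oct_cnj c" by (simp add: c_def)
  have "oct_cnj (c + u) \<odot> ((c + u) \<odot> z) = (norm (c + u))\<^sup>2 *\<^sub>R z"
    by (rule mult_cnj_left)
  then show ?thesis
    unfolding x
    by (simp add: oct_cnj_add oct_mult_add mult_cnj_left power2_norm_eq_inner inner_add
        inner_commute algebra_simps)
qed

text \<open>Multiplying the polarized identity by \<open>u\<close> gives
  \<open>u (x (u z)) = (2 \<langle>cnj x, u\<rangle> u - \<bar>u\<bar>\<^sup>2 cnj x) z\<close>; the factor in front of \<open>z\<close> is
  found by putting \<open>z = 1\<close>.\<close>

lemma oct_left_Moufang: "u \<odot> (x \<odot> (u \<odot> z)) = (u \<odot> (x \<odot> u)) \<odot> z"
proof -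
  define a where "a = (2 * (oct_cnj x \<bullet> u)) *\<^sub>R u - (norm u)\<^sup>2 *\<^sub>R oct_cnj x"
  have eq: "u \<odot> (x \<odot> (u \<odot> z)) = a \<odot> z" for z
    using arg_cong[OF oct_mult_polarized[of x u z], of "\<lambda>y. u \<odot> y"]
      mult_cnj_left[of "oct_cnj u" "oct_cnj x \<odot> z"]
    by (simp add: a_def oct_mult_add oct_mult_diff algebra_simps)
  show ?thesis using eq[of z] eq[of oct_one] by simp
qed

lemma oct_flexible: "x \<odot> (y \<odot> x) = (x \<odot> y) \<odot> x"
proof -
  have polarized: "x \<odot> y = (2 * (oct_cnj x \<bullet> y)) *\<^sub>R oct_one - oct_cnj y \<odot> oct_cnj x"
    using oct_mult_polarized[of x y oct_one] by (simp add: algebra_simps)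
  have "x \<odot> (y \<odot> x) = (2 * (oct_cnj x \<bullet> y)) *\<^sub>R x - (norm x)\<^sup>2 *\<^sub>R oct_cnj y"
    using oct_mult_polarized[of x y x] by (simp add: oct_cnj_mult_self algebra_simps)
  also have "\<dots> = (x \<odot> y) \<odot> x"
    by (simp add: polarized oct_mult_diff mult_cnj_right')
  finally show ?thesis .
qed

section \<open>Polar form and roots\<close>

definition oct_cis :: "oct \<Rightarrow> real \<Rightarrow> oct" where
  "oct_cis v t = cos t *\<^sub>R oct_one + sin t *\<^sub>R v"

lemma oct_cis_mult:
  assumes "v$0 = 0" "norm v = 1"
  shows "oct_cis v s \<odot> oct_cis v t = oct_cis v (s + t)"
proof -
  have "v \<odot> v = - oct_one" using oct_mult_self[of v] assms by simp
  then show ?thesis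
    by (simp add: oct_cis_def oct_mult_add cos_add sin_add algebra_simps)
qed

lemma norm_oct_cis:
  assumes "v$0 = 0" "norm v = 1"
  shows "norm (oct_cis v t) = 1"
proof -
  have "oct_one \<bullet> v = 0" "v \<bullet> oct_one = 0"
    using assms(1) by (simp_all add: oct_one_def inner_axis inner_axis')
  moreover have "v \<bullet> v = 1" "oct_one \<bullet> oct_one = 1"
    using assms(2) by (simp_all add: dot_square_norm)
  ultimately have "(norm (oct_cis v t))\<^sup>2 = (cos t)\<^sup>2 + (sin t)\<^sup>2"
    unfolding power2_norm_eq_inner
    by (simp add: oct_cis_def inner_add power2_eq_square)
  then have "(norm (oct_cis v t))\<^sup>2 = 1" by simp
  then show ?thesis by (simp add: abs_square_eq_1)
qed

lemma oct_polar:
  assumes "norm w = 1"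
  obtains v t where "v$0 = 0" "norm v = 1" "w = oct_cis v t"
proof -
  define z where "z = w - w$0 *\<^sub>R oct_one"
  have z0: "z$0 = 0" by (simp add: z_def oct_one_def)
  obtain v where v: "v$0 = 0" "norm v = 1" "z = norm z *\<^sub>R v"
  proof (cases "z = 0")
    case True
    show thesis by (rule that[of "axis 1 1"]) (simp_all add: True norm_axis_1, simp add: axis_def)
  next
    case False
    show thesis by (rule that[of "z /\<^sub>R norm z"]) (auto simp: False z0)
  qed
  have w: "w = w$0 *\<^sub>R oct_one + norm z *\<^sub>R v"
    unfolding v(3)[symmetric] by (simp add: z_def)
  have "(norm w)\<^sup>2 = (w$0)\<^sup>2 + (norm z)\<^sup>2"
    unfolding norm_oct by (simp add: z_def oct_one_def axis_def)
  then obtain t where "w$0 = cos t" "norm z = sin t"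
    using sincos_total_2pi[of "w$0" "norm z"] assms by auto
  then show thesis using that[OF v(1,2)] w by (metis oct_cis_def)
qed

lemma oct_square_root:
  assumes "norm w = 1"
  obtains s where "norm s = 1" "s \<odot> s = w"
proof -
  obtain v t where v: "v$0 = 0" "norm v = 1" "w = oct_cis v t"
    using oct_polar[OF assms] .
  show thesis
    by (rule that[of "oct_cis v (t / 2)"]) (simp_all add: v norm_oct_cis oct_cis_mult)
qed

lemma oct_cube_root:
  assumes "norm w = 1"
  obtains s where "norm s = 1" "s \<odot> (s \<odot> s) = w"
proof -
  obtain v t where v: "v$0 = 0" "norm v = 1" "w = oct_cis v t"
    using oct_polar[OF assms] .
  show thesis
    by (rule that[of "oct_cis v (t / 3)"]) (simp_all add: v norm_oct_cis oct_cis_mult)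
qed

section \<open>Transitivity of the action\<close>

definition oct_left :: "oct \<Rightarrow> real^8^8" where
  "oct_left u = matrix (\<lambda>x. u \<odot> x)"

lemma linear_oct_mult: "linear (\<lambda>x. u \<odot> x)"
  by (rule linearI) (simp_all add: oct_mult_add)

lemma oct_left_mult: "oct_left u *v x = u \<odot> x"
  using fun_cong[OF matrix_vector_mul(2)[OF linear_oct_mult]] by (simp add: oct_left_def)

lemma tilde_oct_left_mult: "tilde (oct_left u) *v x = x \<odot> oct_cnj u"
  by (simp add: tilde_mult oct_left_mult oct_cnj_mult)

text \<open>Over a square root \<open>s\<close> of \<open>u\<close> the determinant is the square of \<open>det (oct_left s)\<close>, which
  excludes the value \<open>-1\<close> that orthogonality leaves open.\<close>

lemma rotation_oct_left:
  assumes "norm u = 1"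
  shows "rotation_matrix (oct_left u)"
proof -
  have "orthogonal_transformation (\<lambda>x. oct_left u *v x)"
    by (simp add: orthogonal_transformation linear_oct_mult oct_left_mult norm_oct_mult assms)
  then have orth: "orthogonal_matrix (oct_left u)"
    by (simp add: orthogonal_transformation_matrix)
  obtain s where s: "s \<odot> s = u" using oct_square_root[OF assms] by blast
  have "oct_left u = oct_left s ** oct_left s"
    by (simp add: matrix_eq matrix_vector_mul_assoc[symmetric] oct_left_mult
        oct_left_alternative s)
  then have "det (oct_left u) = (det (oct_left s))\<^sup>2"
    by (simp add: det_mul power2_eq_square)
  then have "det (oct_left u) \<noteq> -1"
    by (metis less_le_not_le neg_less_0_iff_less zero_le_power2 zero_less_one)
  then show ?thesis
    using orth det_orthogonal_matrix[OF orth] by (auto simp: rotation_matrix_def)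
qed

text \<open>The defining relation is \<open>u (x y) = (u x u) (cnj u \<cdot> y)\<close>, the Moufang identity at
  \<open>z = cnj u \<cdot> y\<close>.\<close>

lemma left_in_Spin8:
  assumes "norm u = 1"
  shows "(oct_left (oct_cnj u), oct_left u, oct_left u ** tilde (oct_left (oct_cnj u)))
    \<in> carrier Spin8"
proof -
  have "(u \<odot> (x \<odot> u)) \<odot> (oct_cnj u \<odot> y) = u \<odot> (x \<odot> y)" for x y
    using oct_left_Moufang[of u x "oct_cnj u \<odot> y"] mult_cnj_left[of "oct_cnj u" y] assms
    by simp
  then show ?thesis
    by (simp add: Spin8_iff rotation_oct_left rotation_mult rotation_tilde assms oct_left_mult
        tilde_oct_left_mult matrix_vector_mul_assoc[symmetric])
qed

lemma Spin8_left:
  assumes "norm u = 1"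
  obtains g where "g \<in> carrier Spin8"
    "\<And>x y. spin8_act g (x, y) = (oct_cnj u \<odot> x, u \<odot> y)"
  by (rule that[OF left_in_Spin8[OF assms]]) (simp add: oct_left_mult)

text \<open>Triality makes a second Moufang identity unnecessary: the element required is the image
  under \<open>\<tau>\<close> of the one built from left multiplication by \<open>cnj u\<close>.\<close>

lemma Spin8_right:
  assumes "norm u = 1"
  obtains g where "g \<in> carrier Spin8"
    "\<And>x y. spin8_act g (x, y) = (x \<odot> u, u \<odot> (y \<odot> u))"
proof -
  have u: "norm (oct_cnj u) = 1" using assms by simp
  show thesis
    by (rule that[OF tau_carrier[OF left_in_Spin8[OF u]]])
      (simp add: oct_left_mult tilde_oct_left_mult tilde_mul matrix_vector_mul_assoc[symmetric]
        oct_flexible)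
qed

lemma Spin8_transitive:
  assumes "p \<in> X"
  obtains g where "g \<in> carrier Spin8" "spin8_act g base_pt = p"
proof -
  interpret Spin8: group Spin8 by (rule group_Spin8)
  obtain x y where p: "p = (x, y)" and x: "norm x = 1" and y: "norm y = 1"
    using assms by (auto simp: X_def)
  \<comment> \<open>The last factor below maps \<open>(1, w)\<close> to \<open>(x, x w x)\<close>, so \<open>w\<close> must be
    \<open>cnj x \<cdot> y \<cdot> cnj x\<close>.\<close>
  define w where "w = oct_cnj x \<odot> (y \<odot> oct_cnj x)"
  have "norm w = 1" by (simp add: w_def norm_oct_mult x y)
  then obtain u where u: "norm u = 1" "u \<odot> (u \<odot> u) = w" using oct_cube_root by blast
  obtain g1 where g1: "g1 \<in> carrier Spin8"
    "\<And>x y. spin8_act g1 (x, y) = (oct_cnj u \<odot> x, u \<odot> y)"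
    using Spin8_left[OF u(1)] by blast
  obtain g2 where g2: "g2 \<in> carrier Spin8"
    "\<And>x y. spin8_act g2 (x, y) = (x \<odot> u, u \<odot> (y \<odot> u))"
    using Spin8_right[OF u(1)] by blast
  obtain g3 where g3: "g3 \<in> carrier Spin8"
    "\<And>z y. spin8_act g3 (z, y) = (z \<odot> x, x \<odot> (y \<odot> x))"
    using Spin8_right[OF x] by blast
  have "x \<odot> (w \<odot> x) = (x \<odot> w) \<odot> x" by (rule oct_flexible)
  also have "\<dots> = y"
    using mult_cnj_left[of "oct_cnj x" "y \<odot> oct_cnj x"] x
    by (simp add: w_def mult_cnj_right')
  finally have "x \<odot> (w \<odot> x) = y" .
  then have "spin8_act (g3 \<otimes>\<^bsub>Spin8\<^esub> (g2 \<otimes>\<^bsub>Spin8\<^esub> g1)) base_pt = p"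
    by (simp add: spin8_act_mult base_pt_def g1 g2 g3 p oct_cnj_mult_self u)
  then show thesis using that g1 g2 g3 by blast
qed

section \<open>The induced transformations and their fixed points\<close>

lemma tau_in_Gamma_hat: "tau \<in> Gamma_hat"
  by (simp add: Gamma_hat_def generate.incl)

lemma sigma_in_Gamma_hat: "sigma \<in> Gamma_hat"
  by (simp add: Gamma_hat_def generate.incl)

lemma aut_act_sigma:
  assumes "(x, y) \<in> X"
  shows "aut_act sigma (x, y) = (y, x)"
proof -
  obtain g where g: "g \<in> carrier Spin8" "spin8_act g base_pt = (x, y)"
    using Spin8_transitive[OF assms] .
  obtain A B C where [simp]: "g = (A, B, C)" by (cases g)
  show ?thesis
    using aut_act_eq[OF sigma_in_Gamma_hat g(1)] g by (simp add: sigma_def base_pt_def)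
qed

lemma aut_act_tau:
  assumes "(x, y) \<in> X"
  shows "aut_act tau (x, y) = (oct_cnj y, x \<odot> oct_cnj y)"
proof -
  obtain g where g: "g \<in> carrier Spin8" "spin8_act g base_pt = (x, y)"
    using Spin8_transitive[OF assms] .
  obtain A B C where [simp]: "g = (A, B, C)" by (cases g)
  have x: "norm x = 1" using assms by (simp add: X_def)
  have AB: "A *v oct_one = x" "B *v oct_one = y" using g(2) by (simp_all add: base_pt_def)
  have "C *v oct_one = y \<odot> oct_cnj x"
    using Spin8_C[of A B C oct_one oct_one] g(1) AB by (simp add: tilde_mult)
  then show ?thesis
    using aut_act_eq[OF tau_in_Gamma_hat g(1)] g AB
    by (simp add: tau_def base_pt_def tilde_mult oct_cnj_mult)
qed

lemma aut_act_base_pt: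
  assumes "\<gamma> \<in> Gamma_hat"
  shows "aut_act \<gamma> base_pt = base_pt"
proof -
  interpret Spin8: group Spin8 by (rule group_Spin8)
  have fixed: "spin8_act \<one>\<^bsub>Spin8\<^esub> base_pt = base_pt" by (simp add: base_pt_def)
  show ?thesis
    using aut_act_eq[OF assms Spin8.one_closed]
      Gamma_hat_isotropy[OF assms Spin8.one_closed fixed] fixed by simp
qed

lemma oct_cube_eq_one_iff:
  "x \<odot> x \<odot> x = oct_one \<longleftrightarrow> norm x = 1 \<and> x \<odot> x = oct_cnj x"
proof
  assume cube: "x \<odot> x \<odot> x = oct_one"
  then have "norm x ^ 3 = 1"
    by (metis norm_oct_mult norm_oct_one power3_eq_cube)
  then have "norm x = 1"
    using power_eq_1_iff[of "norm x" 3] by simp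
  then show "norm x = 1 \<and> x \<odot> x = oct_cnj x"
    using mult_cnj_right[of "x \<odot> x" x] cube by simp
next
  assume "norm x = 1 \<and> x \<odot> x = oct_cnj x"
  then show "x \<odot> x \<odot> x = oct_one" by (simp add: oct_cnj_mult_self)
qed

text \<open>For a unit octonion, \<open>x\<^sup>2 = cnj x\<close> combined with \<open>x\<^sup>2 = 2 Re x \<cdot> x - 1\<close> and
  \<open>cnj x = 2 Re x - x\<close> reads \<open>(2 Re x + 1) (x - 1) = 0\<close>.\<close>

lemma oct_cube_roots_of_one:
  "x \<odot> x \<odot> x = oct_one \<longleftrightarrow>
    x = oct_one \<or> (\<exists>v \<in> Im_oct \<inter> sphere 0 1. x = (1/2) *\<^sub>R (- oct_one + sqrt 3 *\<^sub>R v))"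
proof -
  have "x = oct_one \<or> (\<exists>v \<in> Im_oct \<inter> sphere 0 1. x = (1/2) *\<^sub>R (- oct_one + sqrt 3 *\<^sub>R v))"
    if cube: "x \<odot> x \<odot> x = oct_one"
  proof -
    have x: "norm x = 1" "x \<odot> x = oct_cnj x" using cube oct_cube_eq_one_iff by blast+
    then have "(2 * x$0 + 1) *\<^sub>R (x - oct_one) = 0"
      by (simp add: oct_mult_self oct_cnj_eq algebra_simps)
    then consider "x = oct_one" | "x$0 = -1/2" by fastforce
    then show ?thesis
    proof cases
      case 2
      define v where "v = (1 / sqrt 3) *\<^sub>R (2 *\<^sub>R x + oct_one)"
      have "v$0 = 0" by (simp add: v_def 2 oct_one_def)
      moreover have "norm v = 1"
      proof -
        have "x \<bullet> oct_one = -1/2" "oct_one \<bullet> x = -1/2" "x \<bullet> x = 1" "oct_one \<bullet> oct_one = 1"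
          using x(1) 2 by (simp_all add: dot_square_norm)
            (simp_all add: oct_one_def inner_axis inner_axis')
        then have "(norm (2 *\<^sub>R x + oct_one))\<^sup>2 = 3"
          unfolding power2_norm_eq_inner by (simp add: inner_add)
        then have "norm (2 *\<^sub>R x + oct_one) = sqrt 3"
          by (metis norm_ge_zero real_sqrt_unique)
        then show ?thesis by (simp add: v_def)
      qed
      moreover have "x = (1/2) *\<^sub>R (- oct_one + sqrt 3 *\<^sub>R v)" by (simp add: v_def)
      ultimately show ?thesis by (auto simp: Im_oct_iff)
    qed simp
  qed
  moreover have "x \<odot> x \<odot> x = oct_one"
    if v: "v \<in> Im_oct \<inter> sphere 0 1" and x: "x = (1/2) *\<^sub>R (- oct_one + sqrt 3 *\<^sub>R v)" for v
  proof -
    have v': "v$0 = 0" "norm v = 1" using v by (simp_all add: Im_oct_iff)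
    have "x = oct_cis v (2 * pi / 3)"
      unfolding oct_cis_def cos_120 sin_120 x by (simp add: algebra_simps)
    then have "x \<odot> x \<odot> x = oct_cis v (2 * pi)" by (simp add: oct_cis_mult v')
    then show ?thesis by (simp add: oct_cis_def)
  qed
  ultimately show ?thesis by auto
qed

lemma Fix_tau: "Fix tau = {(x, oct_cnj x) | x. x \<odot> x \<odot> x = oct_one}"
proof -
  have "(x, y) \<in> Fix tau \<longleftrightarrow> y = oct_cnj x \<and> x \<odot> x \<odot> x = oct_one" for x y
  proof -
    have "(x, y) \<in> Fix tau \<longleftrightarrow> (x, y) \<in> X \<and> (oct_cnj y, x \<odot> oct_cnj y) = (x, y)"
      unfolding Fix_def mem_Collect_eq by (metis aut_act_tau)
    also have "\<dots> \<longleftrightarrow> y = oct_cnj x \<and> norm x = 1 \<and> x \<odot> x = oct_cnj x"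
    proof (cases "y = oct_cnj x")
      case True
      show ?thesis unfolding True by (simp add: X_def)
    next
      case False
      then have "oct_cnj y \<noteq> x" by auto
      then show ?thesis using False by blast
    qed
    finally show ?thesis unfolding oct_cube_eq_one_iff .
  qed
  then have "p \<in> Fix tau \<longleftrightarrow> p \<in> {(x, oct_cnj x) | x. x \<odot> x \<odot> x = oct_one}" for p
    by (cases p) (simp only:, simp)
  then show ?thesis unfolding set_eq_iff by (rule allI)
qed

lemma Fix_sigma: "Fix sigma = {(x, x) | x. x \<in> sphere 0 1}"
proof -
  have "(x, y) \<in> Fix sigma \<longleftrightarrow> (x, y) \<in> X \<and> (y, x) = (x, y)" for x y
    unfolding Fix_def mem_Collect_eq by (metis aut_act_sigma)
  then have "p \<in> Fix sigma \<longleftrightarrow> p \<in> {(x, x) | x. x \<in> sphere 0 1}" for p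
    by (cases p) (simp only:, auto simp: X_def)
  then show ?thesis unfolding set_eq_iff by (rule allI)
qed

lemma Fix_sigma_Int_Fix_tau: "Fix sigma \<inter> Fix tau = {(oct_one, oct_one)}"
proof -
  have one: "x = oct_one" if cube: "x \<odot> x \<odot> x = oct_one" and real: "oct_cnj x = x" for x
  proof -
    have x: "norm x = 1" "x \<odot> x = x"
      using cube real unfolding oct_cube_eq_one_iff by simp_all
    have "x = x \<odot> x" using x(2) by (rule sym)
    also have "\<dots> = oct_cnj x \<odot> x" using real by (rule arg_cong[OF sym])
    also have "\<dots> = oct_one" by (simp add: oct_cnj_mult_self x(1))
    finally show ?thesis .
  qed
  have "Fix sigma \<inter> Fix tau \<subseteq> {(oct_one, oct_one)}"
  proof
    fix p assume p: "p \<in> Fix sigma \<inter> Fix tau"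
    obtain y where p1: "p = (y, oct_cnj y)" and y: "y \<odot> y \<odot> y = oct_one"
      using p unfolding Fix_tau by blast
    have "fst p = snd p" using p unfolding Fix_sigma by auto
    then have "oct_cnj y = y" unfolding p1 by simp
    then show "p \<in> {(oct_one, oct_one)}" using one[OF y] p1 by simp
  qed
  moreover have "(oct_one, oct_one) \<in> Fix sigma" by (simp add: Fix_sigma)
  moreover have "(oct_one, oct_one) \<in> Fix tau" by (simp add: Fix_tau)
  ultimately show ?thesis by blast
qed

theorem mainTheorem2:
  shows "Fix tau = {(x, oct_cnj x) | x. x \<odot> x \<odot> x = oct_one} \<and>
    {(x, oct_cnj x) | x. x \<odot> x \<odot> x = oct_one} =
      {(oct_one, oct_one)} \<union>
      {(x, oct_cnj x) | x v. x = (1/2) *\<^sub>R (- oct_one + sqrt 3 *\<^sub>R v) \<and> v \<in> Im_oct \<inter> sphere 0 1} \<and>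
    Fix sigma = {(x, x) | x. x \<in> sphere 0 1} \<and>
    Fix_group Gamma_hat = Fix sigma \<inter> Fix tau \<and>
    Fix sigma \<inter> Fix tau = {(oct_one, oct_one)}"
proof (intro conjI)
  show "{(x, oct_cnj x) | x. x \<odot> x \<odot> x = oct_one} =
      {(oct_one, oct_one)} \<union>
      {(x, oct_cnj x) | x v. x = (1/2) *\<^sub>R (- oct_one + sqrt 3 *\<^sub>R v) \<and> v \<in> Im_oct \<inter> sphere 0 1}"
    unfolding oct_cube_roots_of_one by force
  have "Fix_group Gamma_hat \<subseteq> Fix sigma \<inter> Fix tau"
    using tau_in_Gamma_hat sigma_in_Gamma_hat by (auto simp: Fix_group_def Fix_def)
  moreover have "base_pt \<in> Fix_group Gamma_hat"
    using aut_act_base_pt by (simp add: Fix_group_def X_def base_pt_def)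
  ultimately show "Fix_group Gamma_hat = Fix sigma \<inter> Fix tau"
    unfolding Fix_sigma_Int_Fix_tau base_pt_def by blast
qed (fact Fix_tau Fix_sigma Fix_sigma_Int_Fix_tau)+

end
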